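(* Assume that $\ker(C)\subseteq\ker(A_1)$ and $\operatorname{Ran}(A_1)\subseteq\operatorname{Ran}(B)$. Then there exists $K_0\in\mathcal L(\mathbb R^p,\mathbb R^m)$ such that $A_1=BK_0C$. Consequently, with this $K_0$ (and any $K_1\in\mathcal L(\mathbb R^p,\mathbb R^m)$), the singular reaction term $\frac{1}{\alpha(t)}(A_1-BK_0C)z$ is eliminated from the closed-loop equation $$\dot z+d(t)A_0z+\frac1{\alpha(t)}(A_1-BK_0C)z+(A_r-BK_1C)z=0,\qquad t\in(0,T],$$ and the closed-loop system reduces to the regularized evolution equation $$\dot z+d(t)A_0z+(A_r-BK_1C)z=0 .$$
   Context: $X$ is a (real) Hilbert space, $A_0:D(A_0)\subset X\to X$ is a densely defined, self-adjoint, strictly positive operator with compact resolvent, $A_1,A_r\in\mathcal L(X)$, $B\in\mathcal L(\mathbb R^m,X)$, $C\in\mathcal L(X,\mathbb R^p)$. The functions $\alpha,\beta\in C^1((0,T])$ are positive on $(0,T]$, $\alpha(0)=0$, and $d(t):=\beta(t)/\alpha(t)$ satisfies $0<d_-\le d(t)\le d_+<\infty$ on $(0,T]$. The closed-loop equation arises from the system $\alpha(t)\dot z+\beta(t)A_0z+A_1z+\alpha(t)A_rz=Bu(t)$, $y=Cz$, with the feedback $u(t)=(K_0+\alpha(t)K_1)y(t)$, after division by $\alpha(t)>0$. *)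

theory Defs
  imports "HOL-Analysis.Analysis"
begin

text \<open>An unbounded operator is a pair of a domain \<open>D\<close> and a total function \<open>A\<close>
  whose values outside \<open>D\<close> are irrelevant.\<close>

definition linear_operator_on :: "'a::real_vector set \<Rightarrow> ('a \<Rightarrow> 'a) \<Rightarrow> bool" where
  "linear_operator_on D A \<longleftrightarrow>
     subspace D \<and>
     (\<forall>x\<in>D. \<forall>y\<in>D. A (x + y) = A x + A y) \<and>
     (\<forall>c. \<forall>x\<in>D. A (c *\<^sub>R x) = c *\<^sub>R A x)"

definition densely_defined :: "'a::topological_space set \<Rightarrow> bool" where
  "densely_defined D \<longleftrightarrow> closure D = UNIV"

definition adjoint_graph :: "'a::real_inner set \<Rightarrow> ('a \<Rightarrow> 'a) \<Rightarrow> ('a \<times> 'a) set" where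
  "adjoint_graph D A = {(y, w). \<forall>x\<in>D. inner (A x) y = inner x w}"

text \<open>The following says that the adjoint has the same domain and the same values,
  not merely that \<open>A\<close> is symmetric.\<close>

definition self_adjoint :: "'a::real_inner set \<Rightarrow> ('a \<Rightarrow> 'a) \<Rightarrow> bool" where
  "self_adjoint D A \<longleftrightarrow> adjoint_graph D A = (\<lambda>x. (x, A x)) ` D"

definition strictly_positive :: "'a::real_inner set \<Rightarrow> ('a \<Rightarrow> 'a) \<Rightarrow> bool" where
  "strictly_positive D A \<longleftrightarrow> (\<exists>c>0. \<forall>x\<in>D. inner (A x) x \<ge> c * (norm x)\<^sup>2)"

text \<open>\<open>R\<close> is the inverse of \<open>\<lambda>I - A\<close>; the space is real, so \<open>\<lambda>\<close> is real.\<close>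

definition is_resolvent ::
  "'a::real_normed_vector set \<Rightarrow> ('a \<Rightarrow> 'a) \<Rightarrow> real \<Rightarrow> ('a \<Rightarrow>\<^sub>L 'a) \<Rightarrow> bool" where
  "is_resolvent D A l R \<longleftrightarrow>
     (\<forall>x. R x \<in> D \<and> l *\<^sub>R R x - A (R x) = x) \<and>
     (\<forall>x\<in>D. R (l *\<^sub>R x - A x) = x)"

definition compact_operator :: "('a::real_normed_vector \<Rightarrow>\<^sub>L 'b::real_normed_vector) \<Rightarrow> bool" where
  "compact_operator R \<longleftrightarrow> compact (closure (blinfun_apply R ` cball 0 1))"

definition compact_resolvent :: "'a::real_normed_vector set \<Rightarrow> ('a \<Rightarrow> 'a) \<Rightarrow> bool" where
  "compact_resolvent D A \<longleftrightarrow> (\<exists>l R. is_resolvent D A l R \<and> compact_operator R)"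

text \<open>Derivatives are taken relative to \<open>S\<close>, hence one-sided at an endpoint of an interval;
  \<open>C1_differentiable_on\<close> would instead ask for a two-sided derivative there.\<close>

definition C1_within :: "real set \<Rightarrow> (real \<Rightarrow> real) \<Rightarrow> bool" where
  "C1_within S f \<longleftrightarrow>
     (\<exists>f'. (\<forall>t\<in>S. (f has_real_derivative f' t) (at t within S)) \<and> continuous_on S f')"

text \<open>\<open>z\<close> is a classical solution on \<open>(0,T]\<close> of \<open>z' + F t z = 0\<close>, where the operators
  \<open>F t\<close> have the common domain \<open>D\<close>.\<close>

definition evolution_solution ::
  "real \<Rightarrow> 'a::real_normed_vector set \<Rightarrow> (real \<Rightarrow> 'a \<Rightarrow> 'a) \<Rightarrow> (real \<Rightarrow> 'a) \<Rightarrow> bool" where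
  "evolution_solution T D F z \<longleftrightarrow>
     (\<forall>t\<in>{0<..T}. z t \<in> D \<and>
        (\<exists>z'. (z has_vector_derivative z') (at t within {0<..T}) \<and> z' + F t (z t) = 0))"

text \<open>The controlled system \<open>\<alpha> z' + \<beta> A\<^sub>0 z + A\<^sub>1 z + \<alpha> A\<^sub>r z = B u\<close>, \<open>y = C z\<close>
  with state \<open>z\<close>, input \<open>u\<close> and output \<open>y\<close>.\<close>

definition plant_solution ::
  "real \<Rightarrow> 'a::real_normed_vector set \<Rightarrow> ('a \<Rightarrow> 'a) \<Rightarrow> ('a \<Rightarrow>\<^sub>L 'a) \<Rightarrow> ('a \<Rightarrow>\<^sub>L 'a) \<Rightarrow>
   ('u::real_normed_vector \<Rightarrow>\<^sub>L 'a) \<Rightarrow> ('a \<Rightarrow>\<^sub>L 'y::real_normed_vector) \<Rightarrow>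
   (real \<Rightarrow> real) \<Rightarrow> (real \<Rightarrow> real) \<Rightarrow>
   (real \<Rightarrow> 'a) \<Rightarrow> (real \<Rightarrow> 'u) \<Rightarrow> (real \<Rightarrow> 'y) \<Rightarrow> bool" where
  "plant_solution T D A0 A1 Ar B C \<alpha> \<beta> z u y \<longleftrightarrow>
     (\<forall>t\<in>{0<..T}. z t \<in> D \<and>
        (\<exists>z'. (z has_vector_derivative z') (at t within {0<..T}) \<and>
           \<alpha> t *\<^sub>R z' + \<beta> t *\<^sub>R A0 (z t) + A1 (z t) + \<alpha> t *\<^sub>R Ar (z t) = B (u t)) \<and>
        y t = C (z t))"

definition feedback_law ::
  "real \<Rightarrow> (real \<Rightarrow> real) \<Rightarrow> ('y::real_normed_vector \<Rightarrow>\<^sub>L 'u::real_normed_vector) \<Rightarrow>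
   ('y \<Rightarrow>\<^sub>L 'u) \<Rightarrow> (real \<Rightarrow> 'u) \<Rightarrow> (real \<Rightarrow> 'y) \<Rightarrow> bool" where
  "feedback_law T \<alpha> K0 K1 u y \<longleftrightarrow> (\<forall>t\<in>{0<..T}. u t = (K0 + \<alpha> t *\<^sub>R K1) (y t))"

end

theory Submission
  imports Defs
begin

text \<open>The heart is algebraic: a linear map that vanishes on ker C and takes values in Ran B
  factors through C on the right and B on the left. Choose linear right inverses G of B and H of C
  on their ranges and put K0 = G A1 H. Since H(Cx) and x differ by an element of ker C, A1 takes the
  same value at both; that value lies in Ran B, where B G is the identity, so B K0 C x = A1 x
  (\<open>blinfun_factorization\<close>). Separately, dividing by \<alpha>(t) > 0 is reversible, so
  plant plus feedback is equivalent to the closed-loop equation for any gains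
  (\<open>plant_feedback_iff_evolution\<close>). With this K0 the singular coefficient is the zero
  operator.\<close>

lemma blinfun_factorization:
  fixes A :: "'x::real_normed_vector \<Rightarrow>\<^sub>L 'z::real_normed_vector"
    and B :: "'u::real_normed_vector \<Rightarrow>\<^sub>L 'z"
    and C :: "'x \<Rightarrow>\<^sub>L 'y::euclidean_space"
  assumes ker: "{x. C x = 0} \<subseteq> {x. A x = 0}"
    and ran: "range (blinfun_apply A) \<subseteq> range (blinfun_apply B)"
  shows "\<exists>K. A = B o\<^sub>L K o\<^sub>L C"
proof -
  have lin: "linear (blinfun_apply F)" for F :: "'v::real_normed_vector \<Rightarrow>\<^sub>L 'w::real_normed_vector"
    by (simp add: blinfun.bounded_linear_right bounded_linear.linear)
  obtain G where G: "linear G" "\<And>v. v \<in> range (blinfun_apply B) \<Longrightarrow> B (G v) = v"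
    using linear_exists_right_inverse_on[OF lin[of B] subspace_UNIV] by blast
  obtain H where H: "linear H" "\<And>w. w \<in> range (blinfun_apply C) \<Longrightarrow> C (H w) = w"
    using linear_exists_right_inverse_on[OF lin[of C] subspace_UNIV] by blast
  define K where "K = Blinfun (\<lambda>y. G (A (H y)))"
  have "linear (\<lambda>y. G (A (H y)))"
    using linear_compose[OF linear_compose[OF H(1) lin[of A]] G(1)] by (simp add: o_def)
  \<comment> \<open>\<open>G\<close> and \<open>H\<close> need not be bounded; the composite is, because \<open>'y\<close> is finite-dimensional.\<close>
  then have K: "K y = G (A (H y))" for y
    unfolding K_def by (simp add: bounded_linear_Blinfun_apply linear_linear)
  have "A x = B (K (C x))" for x
  proof -
    \<comment> \<open>H is only a right inverse, so H(Cx) need not equal x; the kernel hypothesis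
      makes the discrepancy invisible to A.\<close>
    have "C (H (C x) - x) = 0"
      by (simp add: H(2) blinfun.diff_right)
    then have "A (H (C x) - x) = 0"
      using ker by blast
    then have "A (H (C x)) = A x"
      by (simp add: blinfun.diff_right)
    moreover have "A x \<in> range (blinfun_apply B)"
      using ran by blast
    ultimately show ?thesis
      by (simp add: K G(2))
  qed
  then have "A = B o\<^sub>L K o\<^sub>L C"
    by (intro blinfun_eqI) simp
  then show ?thesis ..
qed

lemma evolution_solution_cong:
  assumes "\<And>t x. t \<in> {0<..T} \<Longrightarrow> F t x = G t x"
  shows "evolution_solution T D F z \<longleftrightarrow> evolution_solution T D G z"
  using assms by (simp add: evolution_solution_def)

text \<open>The state determines output and input on (0,T], so both can be eliminated; what remains
  is the plant equation divided by \<alpha>(t).\<close>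

lemma plant_feedback_iff_evolution:
  fixes A1 Ar :: "'x::real_normed_vector \<Rightarrow>\<^sub>L 'x"
    and B :: "'u::real_normed_vector \<Rightarrow>\<^sub>L 'x"
    and C :: "'x \<Rightarrow>\<^sub>L 'y::real_normed_vector"
    and z :: "real \<Rightarrow> 'x"
  assumes pos: "\<And>t. t \<in> {0<..T} \<Longrightarrow> 0 < \<alpha> t"
    and d: "\<And>t. t \<in> {0<..T} \<Longrightarrow> d t = \<beta> t / \<alpha> t"
  shows "(\<exists>u y. plant_solution T D A0 A1 Ar B C \<alpha> \<beta> z u y \<and> feedback_law T \<alpha> K0 K1 u y) \<longleftrightarrow>
    evolution_solution T D (\<lambda>t x. d t *\<^sub>R A0 x
      + (1 / \<alpha> t) *\<^sub>R (A1 - (B o\<^sub>L K0 o\<^sub>L C)) x + (Ar - (B o\<^sub>L K1 o\<^sub>L C)) x) z"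
    (is "?closed \<longleftrightarrow> evolution_solution T D ?F z")
proof -
  have eq: "\<alpha> t *\<^sub>R z' + \<beta> t *\<^sub>R A0 x + A1 x + \<alpha> t *\<^sub>R Ar x
      = B ((K0 + \<alpha> t *\<^sub>R K1) (C x)) \<longleftrightarrow> z' + ?F t x = 0"
    if t: "t \<in> {0<..T}" for t z' x
  proof -
    \<comment> \<open>Multiplying by \<alpha>(t) turns d into \<beta>, cancels 1/\<alpha>, and
      gathers the K0 and K1 terms into the feedback. As \<alpha>(t) is nonzero, one side vanishes
      exactly when the other does.\<close>
    have "\<alpha> t *\<^sub>R (z' + ?F t x) = \<alpha> t *\<^sub>R z' + \<beta> t *\<^sub>R A0 x + A1 x + \<alpha> t *\<^sub>R Ar x
        - B ((K0 + \<alpha> t *\<^sub>R K1) (C x))"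
      using pos[OF t] d[OF t]
      by (simp add: blinfun.bilinear_simps scaleR_right_distrib scaleR_right_diff_distrib)
    then show ?thesis
      using pos[OF t] by (metis eq_iff_diff_eq_0 less_irrefl scaleR_eq_0_iff)
  qed
  show ?thesis
  proof
    assume ?closed
    then show "evolution_solution T D ?F z"
      using eq unfolding plant_solution_def feedback_law_def evolution_solution_def by metis
  next
    assume "evolution_solution T D ?F z"
    \<comment> \<open>The witnesses are forced: y = Cz, and u is the feedback law applied to
      it.\<close>
    then have "plant_solution T D A0 A1 Ar B C \<alpha> \<beta> z
        (\<lambda>t. (K0 + \<alpha> t *\<^sub>R K1) (C (z t))) (\<lambda>t. C (z t))"
      using eq unfolding plant_solution_def evolution_solution_def by metis
    then show ?closed
      unfolding feedback_law_def by blast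
  qed
qed

theorem proposition10:
  fixes D :: "'a::{real_inner, complete_space} set"
    and A0 :: "'a \<Rightarrow> 'a"
    and A1 Ar :: "'a \<Rightarrow>\<^sub>L 'a"
    and B :: "(real ^ 'm) \<Rightarrow>\<^sub>L 'a"
    and C :: "'a \<Rightarrow>\<^sub>L (real ^ 'p)"
    and T dmin dmax :: real
    and \<alpha> \<beta> d :: "real \<Rightarrow> real"
  assumes "linear_operator_on D A0" "densely_defined D" "self_adjoint D A0"
    and "strictly_positive D A0" "compact_resolvent D A0"
    and "0 < T"
    and "C1_within {0<..T} \<alpha>" "C1_within {0<..T} \<beta>"
    and "\<And>t. t \<in> {0<..T} \<Longrightarrow> 0 < \<alpha> t" "\<And>t. t \<in> {0<..T} \<Longrightarrow> 0 < \<beta> t"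
    and "\<alpha> 0 = 0"
    and "\<And>t. t \<in> {0<..T} \<Longrightarrow> d t = \<beta> t / \<alpha> t"
    and "0 < dmin" "\<And>t. t \<in> {0<..T} \<Longrightarrow> dmin \<le> d t \<and> d t \<le> dmax"
    and ker: "{x. C x = 0} \<subseteq> {x. A1 x = 0}"
    and ran: "range (blinfun_apply A1) \<subseteq> range (blinfun_apply B)"
  shows "\<exists>K0 :: (real ^ 'p) \<Rightarrow>\<^sub>L (real ^ 'm).
    A1 = B o\<^sub>L K0 o\<^sub>L C \<and>
    (\<forall>K1 :: (real ^ 'p) \<Rightarrow>\<^sub>L (real ^ 'm).
       (\<forall>t\<in>{0<..T}. \<forall>x. (1 / \<alpha> t) *\<^sub>R (A1 - (B o\<^sub>L K0 o\<^sub>L C)) x = 0) \<and>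
       (\<forall>z. ((\<exists>u y. plant_solution T D A0 A1 Ar B C \<alpha> \<beta> z u y \<and> feedback_law T \<alpha> K0 K1 u y) \<longleftrightarrow>
             evolution_solution T D (\<lambda>t x. d t *\<^sub>R A0 x
                + (1 / \<alpha> t) *\<^sub>R (A1 - (B o\<^sub>L K0 o\<^sub>L C)) x + (Ar - (B o\<^sub>L K1 o\<^sub>L C)) x) z) \<and>
            (evolution_solution T D (\<lambda>t x. d t *\<^sub>R A0 x
                + (1 / \<alpha> t) *\<^sub>R (A1 - (B o\<^sub>L K0 o\<^sub>L C)) x + (Ar - (B o\<^sub>L K1 o\<^sub>L C)) x) z \<longleftrightarrow>
             evolution_solution T D (\<lambda>t x. d t *\<^sub>R A0 x + (Ar - (B o\<^sub>L K1 o\<^sub>L C)) x) z)))"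
proof -
  obtain K0 where K0: "A1 = B o\<^sub>L K0 o\<^sub>L C"
    using blinfun_factorization[OF ker ran] by blast
  then have "A1 - (B o\<^sub>L K0 o\<^sub>L C) = 0"
    by simp
  then have zero: "(1 / \<alpha> t) *\<^sub>R (A1 - (B o\<^sub>L K0 o\<^sub>L C)) x = 0" for t x
    by simp
  show ?thesis
  proof (intro exI[of _ K0] conjI allI ballI)
    show "A1 = B o\<^sub>L K0 o\<^sub>L C"
      by (fact K0)
    show "(1 / \<alpha> t) *\<^sub>R (A1 - (B o\<^sub>L K0 o\<^sub>L C)) x = 0" for t x
      by (fact zero)
  next
    fix K1 z
    show "(\<exists>u y. plant_solution T D A0 A1 Ar B C \<alpha> \<beta> z u y \<and> feedback_law T \<alpha> K0 K1 u y) \<longleftrightarrow>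
        evolution_solution T D (\<lambda>t x. d t *\<^sub>R A0 x
          + (1 / \<alpha> t) *\<^sub>R (A1 - (B o\<^sub>L K0 o\<^sub>L C)) x + (Ar - (B o\<^sub>L K1 o\<^sub>L C)) x) z"
      \<comment> \<open>The facts used are \<alpha> > 0 and d = \<beta>/\<alpha> on (0,T]; the
        choice of K0 enters in the next equivalence, through \<open>zero\<close>.\<close>
      using assms(9,12) by (rule plant_feedback_iff_evolution)
    show "evolution_solution T D (\<lambda>t x. d t *\<^sub>R A0 x
          + (1 / \<alpha> t) *\<^sub>R (A1 - (B o\<^sub>L K0 o\<^sub>L C)) x + (Ar - (B o\<^sub>L K1 o\<^sub>L C)) x) z \<longleftrightarrow>
        evolution_solution T D (\<lambda>t x. d t *\<^sub>R A0 x + (Ar - (B o\<^sub>L K1 o\<^sub>L C)) x) z"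
      by (rule evolution_solution_cong) (simp only: zero add_0_right)
  qed
qed

end
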